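(* For all integers $e,r\geq 2$ we have $$\left\lfloor\frac e2\right\rfloor\left\lfloor\frac{r^2}{4}\right\rfloor \leq N_{r,e}\leq N'_{r,e}\leq\frac{er^2}{8}.$$
   Context: Set $N'_{r,e}:=\left\lfloor\frac{r^2}{2e}\left\lfloor\frac{e^2}{4}\right\rfloor\right\rfloor$. Definition of $N_{r,e}$. A partition is a finite non-increasing sequence $\lambda = (\lambda_1\geq\dots\geq\lambda_h>0)$ of positive integers (possibly empty), with Young diagram $\{(a,b): 1\le a\le h,\ 1\le b\le \lambda_a\}$. An $r$-partition is an $r$-tuple $\boldsymbol\lambda=(\lambda^{(1)},\dots,\lambda^{(r)})$ of partitions; its nodes are the triples $(a,b,j)$ with $(a,b)$ in the Young diagram of $\lambda^{(j)}$. For a multicharge $\mathsf{s}=(s_1,\dots,s_r)\in\mathbb{Z}^r$, the $\mathsf{s}$-residue of $(a,b,j)$ is $b-a+s_j \bmod e$, and $c_i^{\mathsf{s}}(\boldsymbol\lambda)$ is the number of nodes of $\mathsf{s}$-residue $i\in\mathbb{Z}/e\mathbb{Z}$. The $\mathsf{s}$-weight is $\mathsf{w}^{\mathsf{s}}(\boldsymbol\lambda):=\sum_{j=1}^r c^{\mathsf{s}}_{s_j}(\boldsymbol\lambda)-\frac12\sum_{i\in\mathbb{Z}/e\mathbb{Z}}(c^{\mathsf{s}}_i(\boldsymbol\lambda)-c^{\mathsf{s}}_{i+1}(\boldsymbol\lambda))^2$ (indices modulo $e$). $Q=\bigoplus_{i\in\mathbb{Z}/e\mathbb{Z}}\mathbb{Z}\alpha_i$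 is free abelian with basis $(\alpha_i)$; $\delta:=\sum_i\alpha_i$; $\alpha^{\mathsf{s}}(\boldsymbol\lambda):=\sum_i c_i^{\mathsf{s}}(\boldsymbol\lambda)\alpha_i$; $Q^{\mathsf{s}}:=\{\alpha^{\mathsf{s}}(\boldsymbol\lambda):\boldsymbol\lambda\text{ an }r\text{-partition}\}$. An $r$-partition $\boldsymbol\lambda$ is an $\mathsf{s}$-reduced $e$-multicore if $\alpha^{\mathsf{s}}(\boldsymbol\lambda)-\delta\notin Q^{\mathsf{s}}$. Then $$N_{r,e}:=\sup\{\mathsf{w}^{\mathsf{s}}(\boldsymbol\lambda):\mathsf{s}\in\mathbb{Z}^r,\ \boldsymbol\lambda\text{ an }\mathsf{s}\text{-reduced }e\text{-multicore}\},$$ which is known to be finite. *)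

theory Defs
  imports Complex_Main "HOL-Library.Poly_Mapping" "HOL-Library.Extended_Real"
begin

definition is_partition :: "nat list \<Rightarrow> bool" where
  "is_partition p \<longleftrightarrow> sorted_wrt (\<ge>) p \<and> (\<forall>x\<in>set p. 0 < x)"

text \<open>Rows, columns and components are numbered from 1, whereas list positions start at 0.\<close>

definition young_diagram :: "nat list \<Rightarrow> (nat \<times> nat) set" where
  "young_diagram p = {(a, b). 1 \<le> a \<and> a \<le> length p \<and> 1 \<le> b \<and> b \<le> p ! (a - 1)}"

definition is_multipartition :: "nat \<Rightarrow> nat list list \<Rightarrow> bool" where
  "is_multipartition r L \<longleftrightarrow> length L = r \<and> (\<forall>p\<in>set L. is_partition p)"

definition nodes :: "nat list list \<Rightarrow> (nat \<times> nat \<times> nat) set" where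
  "nodes L = {(a, b, j). 1 \<le> j \<and> j \<le> length L \<and> (a, b) \<in> young_diagram (L ! (j - 1))}"

text \<open>
  The residue ring modulo \<open>e\<close> is represented by the integers \<open>{0..<e}\<close>. A multicharge is an
  integer list whose length is the number of components.
\<close>

fun residue :: "nat \<Rightarrow> int list \<Rightarrow> nat \<times> nat \<times> nat \<Rightarrow> int" where
  "residue e s (a, b, j) = (int b - int a + s ! (j - 1)) mod int e"

text \<open>
  The index \<open>i\<close> is read modulo \<open>e\<close>, so that \<open>residue_count e s L (i + 1)\<close> wraps around and
  \<open>residue_count e s L (s ! k)\<close> makes sense for an arbitrary charge.
\<close>

definition residue_count :: "nat \<Rightarrow> int list \<Rightarrow> nat list list \<Rightarrow> int \<Rightarrow> nat" where
  "residue_count e s L i = card {n \<in> nodes L. residue e s n = i mod int e}"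

definition weight :: "nat \<Rightarrow> int list \<Rightarrow> nat list list \<Rightarrow> real" where
  "weight e s L =
     (\<Sum>j = 1..length s. real (residue_count e s L (s ! (j - 1))))
     - 1 / 2 * (\<Sum>i\<in>{0..<int e}.
         (real (residue_count e s L i) - real (residue_count e s L (i + 1)))\<^sup>2)"

text \<open>
  The free abelian group \<open>Q\<close> consists of the elements of \<open>int \<Rightarrow>\<^sub>0 int\<close> supported in
  \<open>{0..<e}\<close>; its basis element with index \<open>i\<close> is \<open>frag_of i\<close>.
\<close>

definition delta :: "nat \<Rightarrow> int \<Rightarrow>\<^sub>0 int" where
  "delta e = (\<Sum>i\<in>{0..<int e}. frag_of i)"

definition alpha :: "nat \<Rightarrow> int list \<Rightarrow> nat list list \<Rightarrow> int \<Rightarrow>\<^sub>0 int" where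
  "alpha e s L = (\<Sum>i\<in>{0..<int e}. frag_cmul (int (residue_count e s L i)) (frag_of i))"

definition Q_set :: "nat \<Rightarrow> int list \<Rightarrow> (int \<Rightarrow>\<^sub>0 int) set" where
  "Q_set e s = {alpha e s L | L. is_multipartition (length s) L}"

definition reduced_multicore :: "nat \<Rightarrow> int list \<Rightarrow> nat list list \<Rightarrow> bool" where
  "reduced_multicore e s L \<longleftrightarrow>
     is_multipartition (length s) L \<and> alpha e s L - delta e \<notin> Q_set e s"

text \<open>
  The supremum is taken in the extended reals, where it is meaningful without prior knowledge
  that the weights are bounded.
\<close>

definition N :: "nat \<Rightarrow> nat \<Rightarrow> ereal" where
  "N r e = Sup {ereal (weight e s L) | s L. length s = r \<and> reduced_multicore e s L}"

definition N' :: "nat \<Rightarrow> nat \<Rightarrow> int" where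
  "N' r e = \<lfloor>(real r)\<^sup>2 / (2 * real e) * real_of_int \<lfloor>(real e)\<^sup>2 / 4\<rfloor>\<rfloor>"

text \<open>Cardinalities of infinite sets are 0; this does not affect \<open>residue_count\<close>.\<close>

lemma finite_nodes: "finite (nodes L)"
proof -
  have "nodes L \<subseteq> (\<Union>j\<in>{1..length L}. \<Union>a\<in>{1..length (L ! (j - 1))}.
      \<Union>b\<in>{1..L ! (j - 1) ! (a - 1)}. {(a, b, j)})"
    by (auto simp: nodes_def young_diagram_def)
  then show ?thesis
    by (rule finite_subset) auto
qed

end

theory Submission
  imports Defs
begin

text \<open>
  Everything is read off the vector \<open>c\<close> of residue counts, an \<open>e\<close>-periodic function on the
  integers. Let \<open>h\<^sub>i = #{j. s\<^sub>j \<equiv> i} + c\<^sub>i\<^sub>-\<^sub>1 + c\<^sub>i\<^sub>+\<^sub>1 - 2c\<^sub>i\<close>, the number of addable minus the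
  number of removable \<open>i\<close>-nodes, called the hub below; in Lie-theoretic terms it is the value of the weight
  \<open>\<Lambda> - \<alpha>\<close> on the \<open>i\<close>-th simple coroot of the affine Lie algebra of \<open>sl\<^sub>e\<close>.

  Upper bound. Adding all addable and removing all removable \<open>i\<close>-nodes changes \<open>c\<close> by \<open>h\<^sub>i\<close> at \<open>i\<close>
  (a simple reflection of the affine Weyl group, \<open>contents_reflect\<close>). This preserves the
  weight, and it preserves being reduced because it commutes with subtracting \<open>\<delta>\<close>. As long as
  some \<open>h\<^sub>i\<close> is negative the reflection lowers the total number of nodes, so a reduced
  vector may be assumed dominant, that is, \<open>h\<^sub>i \<ge> 0\<close> for all \<open>i\<close>. The central point is that every
  nonnegative dominant vector is a vector of residue counts (\<open>dominant_in_contents\<close>): one fills it up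
  node by node, and positivity of the Cartan form shows that one can never get stuck. Hence a
  dominant reduced vector must have a vanishing entry, since otherwise its difference with \<open>\<delta>\<close> would
  still be nonnegative and dominant. If \<open>c\<^sub>k = 0\<close>, then going from \<open>k\<close> to a residue \<open>a\<close> in \<open>m\<close>
  steps one way and \<open>e - m\<close> steps the other way, Cauchy-Schwarz gives
  \<open>\<Sum>(c\<^sub>i - c\<^sub>i\<^sub>+\<^sub>1)\<^sup>2 \<ge> c\<^sub>a\<^sup>2 e / (m(e - m))\<close>, so that
  \<open>r c\<^sub>a - \<Sum>(c\<^sub>i - c\<^sub>i\<^sub>+\<^sub>1)\<^sup>2 / 2 \<le> r\<^sup>2 m(e - m) / (2e)\<close>. Averaging over the charges \<open>a = s\<^sub>j\<close>
  bounds the weight by \<open>r\<^sup>2 \<lfloor>e\<^sup>2/4\<rfloor> / (2e)\<close>, and the weight is an integer.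

  Lower bound. Take all charges equal to 0 and let \<open>\<lfloor>r/2\<rfloor>\<close> of the components be squares of side
  \<open>k = \<lfloor>e/2\<rfloor>\<close>, the others being empty. No node has residue \<open>k\<close>, so the multipartition is
  reduced for the trivial reason that a count cannot become negative, and its weight is
  \<open>k \<lfloor>r\<^sup>2/4\<rfloor>\<close>.
\<close>

section \<open>Residue counts of a single partition\<close>

definition point :: "nat \<Rightarrow> int \<Rightarrow> int \<Rightarrow> int" where
  "point e i k = (if k mod int e = i mod int e then 1 else 0)"

lemma point_sym: "point e i k = point e k i"
  by (simp add: point_def)

definition part_count :: "nat \<Rightarrow> int \<Rightarrow> nat list \<Rightarrow> int \<Rightarrow> int" where
  "part_count e s p i =
     int (card {(a, b) \<in> young_diagram p. (int b - int a + s) mod int e = i mod int e})"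

lemma finite_young_diagram: "finite (young_diagram p)"
proof -
  have "young_diagram p \<subseteq> (\<Union>a\<in>{1..length p}. \<Union>b\<in>{1..p ! (a - 1)}. {(a, b)})"
    by (auto simp: young_diagram_def)
  then show ?thesis
    by (rule finite_subset) auto
qed

lemma div_step:
  assumes "e \<ge> 1"
  shows "(t + 1 - i) div int e = (t - i) div int e + point e i (t + 1)"
proof -
  have "(t + 1) mod int e = i mod int e \<longleftrightarrow> int e dvd (t + 1 - i)"
    by (simp add: mod_eq_dvd_iff)
  moreover have "(t + 1 - i) div int e = (t - i) div int e + (if int e dvd (t + 1 - i) then 1 else 0)"
  proof -
    define q where "q = (t + 1 - i) div int e"
    define m where "m = (t + 1 - i) mod int e"
    have m: "0 \<le> m" "m < int e" "t + 1 - i = int e * q + m"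
      using assms by (auto simp: q_def m_def)
    have d: "int e dvd (t + 1 - i) \<longleftrightarrow> m = 0"
      by (simp add: m_def dvd_eq_mod_eq_0)
    have "(t - i) div int e = (if m = 0 then q - 1 else q)"
    proof (cases "m = 0")
      case True
      have "(t - i) div int e = q - 1"
        by (rule int_div_pos_eq[where r = "int e - 1"]) (use m True assms in \<open>auto simp: algebra_simps\<close>)
      with True show ?thesis by simp
    next
      case False
      have "(t - i) div int e = q"
        by (rule int_div_pos_eq[where r = "m - 1"]) (use m False in auto)
      with False show ?thesis by simp
    qed
    then show ?thesis by (simp add: d flip: q_def)
  qed
  ultimately show ?thesis by (simp add: point_def)
qed

lemma part_count_Nil [simp]: "part_count e s [] i = 0"
proof -
  have "young_diagram [] = {}"
    by (auto simp: young_diagram_def)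
  then show ?thesis by (simp add: part_count_def)
qed

lemma row_count:
  assumes "e \<ge> 1"
  shows "int (card {b \<in> {1..x}. (int b - 1 + s) mod int e = i mod int e})
           = (s - 1 + int x - i) div int e - (s - 1 - i) div int e"
proof (induction x)
  case 0
  then show ?case by simp
next
  case (Suc x)
  have "{b \<in> {1..Suc x}. (int b - 1 + s) mod int e = i mod int e}
      = {b \<in> {1..x}. (int b - 1 + s) mod int e = i mod int e}
        \<union> (if (int x + s) mod int e = i mod int e then {Suc x} else {})"
    by (auto simp: le_Suc_eq)
  then have "int (card {b \<in> {1..Suc x}. (int b - 1 + s) mod int e = i mod int e})
      = int (card {b \<in> {1..x}. (int b - 1 + s) mod int e = i mod int e}) + point e i (int x + s)"
    by (simp add: point_def card_insert_if)
  with Suc show ?case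
    using div_step[OF assms, of "s - 1 + int x" i] by (simp add: algebra_simps)
qed

text \<open>
  Deleting the first row and lowering the charge by one keeps the residues of the remaining
  nodes. This recursion carries the translation into bead sets below.
\<close>

lemma part_count_Cons:
  assumes "e \<ge> 1"
  shows "part_count e s (x # p) i
           = (s - 1 + int x - i) div int e - (s - 1 - i) div int e + part_count e (s - 1) p i"
proof -
  let ?P = "\<lambda>s p. {(a, b) \<in> young_diagram p. (int b - int a + s) mod int e = i mod int e}"
  let ?R = "{b \<in> {1..x}. (int b - 1 + s) mod int e = i mod int e}"
  have "?P s (x # p) = Pair 1 ` ?R \<union> (\<lambda>(a, b). (Suc a, b)) ` ?P (s - 1) p" (is "?A = ?B \<union> ?C")
  proof (intro set_eqI iffI)
    fix z assume z: "z \<in> ?A"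
    obtain a b where ab: "z = (a, b)" by (cases z)
    show "z \<in> ?B \<union> ?C"
    proof (cases "a = 1")
      case True
      then show ?thesis using z ab by (auto simp: young_diagram_def algebra_simps)
    next
      case False
      with z ab obtain a' where a': "a = Suc a'" "a' \<ge> 1"
        by (cases a) (auto simp: young_diagram_def)
      then have "(a', b) \<in> ?P (s - 1) p"
        using z ab by (auto simp: young_diagram_def nth_Cons' algebra_simps)
      then show ?thesis using a' ab by force
    qed
  next
    fix z assume "z \<in> ?B \<union> ?C"
    then show "z \<in> ?A"
      by (auto simp: young_diagram_def nth_Cons' algebra_simps)
  qed
  moreover have "finite ?B" "finite ?C"
    using finite_subset[OF _ finite_young_diagram, of "?P (s - 1) p"] by auto
  moreover have "?B \<inter> ?C = {}"
    by (auto simp: young_diagram_def)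
  moreover have "card ?B = card ?R"
    by (rule card_image) (auto simp: inj_on_def)
  moreover have "card ?C = card (?P (s - 1) p)"
    by (rule card_image) (auto simp: inj_on_def)
  ultimately have "card (?P s (x # p)) = card ?R + card (?P (s - 1) p)"
    by (simp add: card_Un_disjoint)
  then show ?thesis
    using row_count[OF assms, of x s i] by (simp add: part_count_def)
qed

section \<open>Partitions as bead sets\<close>

text \<open>
  Push the row \<open>a\<close> of a partition with charge \<open>s\<close> to the position \<open>p\<^sub>a - a + s\<close>: the partition becomes
  a finite set \<open>B\<close> of beads above a bottom position \<open>b\<close>, with the empty partition corresponding to
  \<open>{b..<s}\<close>. A bead moving up passes one node of residue \<open>i\<close> whenever it reaches a position
  congruent to \<open>i\<close>, which is what the floor functions count. Since only a sum over \<open>B\<close> is left, the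
  order of the rows no longer matters.
\<close>

definition bead_count :: "nat \<Rightarrow> int \<Rightarrow> int \<Rightarrow> int set \<Rightarrow> int \<Rightarrow> int" where
  "bead_count e b s B i = (\<Sum>t\<in>B. (t - i) div int e) - (\<Sum>t\<in>{b..<s}. (t - i) div int e)"

text \<open>
  The bound on the beads makes the induction work: it shows that the bead of a new
  first row is not yet occupied.
\<close>

lemma exists_beads:
  assumes "e \<ge> 1" "is_partition p" "b + int (length p) \<le> s"
  shows "\<exists>B. finite B \<and> B \<subseteq> {b..} \<and> int (card B) = s - b
    \<and> (\<forall>t\<in>B. t < s + (if p = [] then 0 else int (hd p)))
    \<and> (\<forall>i. part_count e s p i = bead_count e b s B i)"
  using assms(2,3)
proof (induction p arbitrary: s)
  case Nil
  then show ?case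
    by (intro exI[of _ "{b..<s}"]) (auto simp: bead_count_def)
next
  case (Cons x p)
  then have p: "is_partition p" and x: "x > 0" and hd: "p \<noteq> [] \<Longrightarrow> hd p \<le> x"
    by (auto simp: is_partition_def)
  obtain B where B: "finite B" "B \<subseteq> {b..}" "int (card B) = s - 1 - b"
      "\<And>t. t \<in> B \<Longrightarrow> t < s - 1 + (if p = [] then 0 else int (hd p))"
      "\<And>i. part_count e (s - 1) p i = bead_count e b (s - 1) B i"
    using Cons.IH[OF p, of "s - 1"] Cons.prems(2) by auto
  have lt: "t < s - 1 + int x" if "t \<in> B" for t
    using B(4)[OF that] hd x by (auto split: if_splits)
  then have notin: "s - 1 + int x \<notin> B" by blast
  have "{b..<s} = insert (s - 1) {b..<s - 1}"
    using Cons.prems(2) by auto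
  then have "part_count e s (x # p) i = bead_count e b s (insert (s - 1 + int x) B) i" for i
    using notin B(1) by (simp add: part_count_Cons[OF assms(1)] B(5) bead_count_def)
  then show ?case
    using B(1-3) lt notin Cons.prems(2)
    by (intro exI[of _ "insert (s - 1 + int x) B"]) force
qed

text \<open>
  The largest bead is the first row. Either it has not moved, and then no bead has, or
  removing it leaves a bead set for the charge \<open>s - 1\<close>; the bound on the parts shows that the row
  prepended in the second case is the longest one.
\<close>

lemma exists_partition:
  assumes "e \<ge> 1" "finite B" "B \<subseteq> {b..}" "int (card B) = s - b"
  shows "\<exists>p. is_partition p \<and> (\<forall>x\<in>set p. \<exists>t\<in>B. int x \<le> t - (s - 1))
    \<and> (\<forall>i. part_count e s p i = bead_count e b s B i)"
  using assms(2-4)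
proof (induction "card B" arbitrary: B s)
  case 0
  then show ?case
    by (intro exI[of _ "[]"]) (auto simp: is_partition_def bead_count_def)
next
  case (Suc n)
  define M where "M = Max B"
  have "B \<noteq> {}" using Suc.hyps(2) by auto
  then have MB: "M \<in> B" and le: "\<And>t. t \<in> B \<Longrightarrow> t \<le> M"
    using Suc.prems(1) by (auto simp: M_def)
  have sub: "B \<subseteq> {b..M}" using le Suc.prems(2) by auto
  have Mge: "M \<ge> s - 1"
    using card_mono[OF _ sub] Suc.prems(3) Suc.hyps(2) by simp
  show ?case
  proof (cases "M = s - 1")
    case True
    have "card B = card {b..M}"
      using Suc.prems(3) Suc.hyps(2) True by simp
    then have "B = {b..M}"
      using sub by (intro card_subset_eq) auto
    also have "\<dots> = {b..<s}" using True by auto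
    finally show ?thesis
      by (intro exI[of _ "[]"]) (simp add: is_partition_def bead_count_def)
  next
    case False
    define B' where "B' = B - {M}"
    have B': "finite B'" "B' \<subseteq> {b..}" "int (card B') = s - 1 - b" "n = card B'" "M \<notin> B'" "B = insert M B'"
      using Suc.prems Suc.hyps(2) MB by (auto simp: B'_def)
    obtain p where p: "is_partition p" "\<And>x. x \<in> set p \<Longrightarrow> \<exists>t\<in>B'. int x \<le> t - (s - 1 - 1)"
        "\<And>i. part_count e (s - 1) p i = bead_count e b (s - 1) B' i"
      using Suc.hyps(1)[OF B'(4,1,2,3)] by blast
    define y where "y = nat (M - (s - 1))"
    have y: "int y = M - (s - 1)" "y > 0" using Mge False by (auto simp: y_def)
    have small: "x \<le> y" if x: "x \<in> set p" for x
    proof -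
      obtain t where t: "t \<in> B'" "int x \<le> t - (s - 1 - 1)" using p(2)[OF x] by blast
      then have "t < M" using le[of t] B' by (cases "t = M") auto
      then show ?thesis using t y by linarith
    qed
    have "is_partition (y # p)" using p(1) small y(2) by (auto simp: is_partition_def)
    moreover have "\<exists>t\<in>B. int x \<le> t - (s - 1)" if "x \<in> set (y # p)" for x
    proof -
      have "x \<le> y" using that small by auto
      then have "int x \<le> M - (s - 1)" using y by linarith
      then show ?thesis using MB by blast
    qed
    moreover have "{b..<s} = insert (s - 1) {b..<s - 1}"
      using Suc.prems(3) Suc.hyps(2) by auto
    then have "part_count e s (y # p) i = bead_count e b s B i" for i
      using B' y by (simp add: part_count_Cons[OF assms(1)] p(3) bead_count_def)
    ultimately show ?thesis by blast
  qed
qed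

section \<open>Adding nodes and reflecting\<close>

definition laplacian :: "(int \<Rightarrow> int) \<Rightarrow> int \<Rightarrow> int" where
  "laplacian c i = 2 * c i - c (i - 1) - c (i + 1)"

text \<open>
  For residue counts of a multipartition this is the number of addable minus the number of
  removable \<open>i\<close>-nodes, written in terms of the counts alone.
\<close>

definition hub :: "nat \<Rightarrow> int list \<Rightarrow> (int \<Rightarrow> int) \<Rightarrow> int \<Rightarrow> int" where
  "hub e s c i = (\<Sum>j<length s. point e (s ! j) i) - laplacian c i"

text \<open>
  Moving beads between the residue classes of \<open>i - 1\<close> and \<open>i\<close> must not push a bead below the bottom
  position. This is guaranteed if the bottom is not congruent to \<open>i\<close>.
\<close>

lemma ground_bottom_below:
  assumes "e \<ge> 2"
  obtains b where "b \<le> m" "b mod int e \<noteq> i mod int e"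
proof (cases "m mod int e = i mod int e")
  case True
  have "(m - 1) mod int e \<noteq> m mod int e"
  proof
    assume "(m - 1) mod int e = m mod int e"
    then have "int e dvd 1" by (simp add: mod_eq_dvd_iff)
    with assms show False by simp
  qed
  with True that[of "m - 1"] show ?thesis by simp
qed (use that in auto)

lemma sum_point_ground:
  assumes "b \<le> s"
  shows "(\<Sum>t\<in>{b..<s}. point e i (t + 1) - point e i t) = point e i s - point e i b"
  using assms
proof (induction s rule: int_ge_induct)
  case (step s)
  have "{b..<s + 1} = insert s {b..<s}" using step.hyps by auto
  with step show ?case by simp
qed simp

text \<open>
  The floor function jumps exactly at the positions congruent to \<open>i\<close>, so its second difference
  in \<open>i\<close> counts beads in the residue classes of \<open>i - 1\<close> and \<open>i\<close>. The contribution of the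
  ground set \<open>{b..<s}\<close> telescopes to the charge term of the hub.
\<close>

lemma hub_bead_count:
  assumes "e \<ge> 1" "b \<le> s" "finite B" "b mod int e \<noteq> i mod int e"
  shows "hub e [s] (bead_count e b s B) i = (\<Sum>t\<in>B. point e i (t + 1) - point e i t)"
proof -
  have lap: "2 * ((t - i) div int e) - (t - (i - 1)) div int e - (t - (i + 1)) div int e
      = point e i t - point e i (t + 1)" for t
    using div_step[OF assms(1), of t i] div_step[OF assms(1), of "t - 1" i]
    by (simp add: algebra_simps)
  have sum_lap: "2 * (\<Sum>t\<in>A. (t - i) div int e) - (\<Sum>t\<in>A. (t - (i - 1)) div int e)
      - (\<Sum>t\<in>A. (t - (i + 1)) div int e) = (\<Sum>t\<in>A. point e i t - point e i (t + 1))" for A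
    by (simp only: sum_distrib_left flip: sum_subtractf lap)
  have "laplacian (bead_count e b s B) i = (\<Sum>t\<in>B. point e i t - point e i (t + 1))
      - (\<Sum>t\<in>{b..<s}. point e i t - point e i (t + 1))"
    by (simp only: laplacian_def bead_count_def flip: sum_lap) (simp only: algebra_simps)
  moreover have "point e i b = 0"
    using assms(4) by (simp add: point_def)
  ultimately show ?thesis
    using sum_point_ground[OF assms(2), of e i]
    by (simp add: hub_def point_sym[of e s i] sum_subtractf)
qed

lemma partition_beads:
  assumes "e \<ge> 2" "is_partition p"
  obtains b B where "b \<le> s" "b mod int e \<noteq> i mod int e" "finite B" "B \<subseteq> {b..}" "int (card B) = s - b"
    "part_count e s p = bead_count e b s B"
proof -
  obtain b where b: "b \<le> s - int (length p)" "b mod int e \<noteq> i mod int e"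
    using ground_bottom_below[OF assms(1)] by blast
  then show ?thesis
    using exists_beads[of e p b s] assms that[of b] by (auto simp: fun_eq_iff)
qed

text \<open>
  There are more beads congruent to \<open>i - 1\<close> than beads congruent to \<open>i\<close>, hence some bead of the
  first kind has a free position above it.
\<close>

lemma add_node:
  assumes "e \<ge> 2" "is_partition p" "hub e [s] (part_count e s p) i > 0"
  shows "\<exists>q. is_partition q \<and> part_count e s q = (\<lambda>k. part_count e s p k + point e i k)"
proof -
  obtain b B where b: "b \<le> s" "b mod int e \<noteq> i mod int e" "finite B" "B \<subseteq> {b..}"
      "int (card B) = s - b" "part_count e s p = bead_count e b s B"
    using partition_beads[OF assms(1,2)] by blast
  define X where "X = {t \<in> B. (t + 1) mod int e = i mod int e}"
  define Y where "Y = {t \<in> B. t mod int e = i mod int e}"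
  have fin: "finite X" "finite Y" using b(3) by (auto simp: X_def Y_def)
  have "(\<Sum>t\<in>B. point e i (t + 1)) = int (card X)" "(\<Sum>t\<in>B. point e i t) = int (card Y)"
    using b(3) by (simp_all add: point_def X_def Y_def flip: sum.inter_filter)
  then have "card Y < card X"
    using assms(1,3) b by (simp add: hub_bead_count sum_subtractf)
  moreover have "card X = card ((\<lambda>t. t + 1) ` X)"
    by (simp add: card_image)
  ultimately have "\<not> (\<lambda>t. t + 1) ` X \<subseteq> Y"
    using card_mono[OF fin(2), of "(\<lambda>t. t + 1) ` X"] by linarith
  then obtain t where "t \<in> X" "t + 1 \<notin> Y"
    by blast
  then have t: "t \<in> B" "(t + 1) mod int e = i mod int e" "t + 1 \<notin> B"
    by (simp_all add: X_def Y_def)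
  define B' where "B' = insert (t + 1) (B - {t})"
  have "card B' = card B"
    using t(1,3) b(3) card_Suc_Diff1[of B t] by (simp add: B'_def)
  moreover have "finite B'" "B' \<subseteq> {b..}"
    using b t by (auto simp: B'_def)
  ultimately obtain q where q: "is_partition q" "\<And>i. part_count e s q i = bead_count e b s B' i"
    using exists_partition[of e B' b s] assms(1) b(5) by auto
  have "(\<Sum>u\<in>B'. (u - k) div int e) = (\<Sum>u\<in>B. (u - k) div int e) + point e i k" for k
  proof -
    have "point e k (t + 1) = point e i k"
      using t(2) by (auto simp: point_def)
    then show ?thesis
      using b(3) t div_step[of e t k] assms(1)
      by (simp add: B'_def sum.remove[of B t])
  qed
  then show ?thesis
    using q b(6) by (intro exI[of _ q]) (simp add: fun_eq_iff bead_count_def)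
qed

text \<open>
  Exchanging the positions \<open>t - 1\<close> and \<open>t\<close> for all \<open>t\<close> congruent to \<open>i\<close> adds all addable and removes all
  removable \<open>i\<close>-nodes.
\<close>

lemma reflect_partition:
  assumes "e \<ge> 2" "is_partition p"
  shows "\<exists>q. is_partition q \<and> part_count e s q
    = (\<lambda>k. part_count e s p k + hub e [s] (part_count e s p) i * point e i k)"
proof -
  obtain b B where b: "b \<le> s" "b mod int e \<noteq> i mod int e" "finite B" "B \<subseteq> {b..}"
      "int (card B) = s - b" "part_count e s p = bead_count e b s B"
    using partition_beads[OF assms(1,2)] by blast
  define \<sigma> where "\<sigma> t = t + point e i (t + 1) - point e i t" for t
  have ne: "(t + 1) mod int e \<noteq> t mod int e" for t
  proof
    assume "(t + 1) mod int e = t mod int e"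
    then have "int e dvd 1" by (simp add: mod_eq_dvd_iff)
    with assms show False by simp
  qed
  \<comment> \<open>\<open>\<sigma>\<close> is the exchange of the classes of \<open>i - 1\<close> and \<open>i\<close>; the indicators cannot both be 1.\<close>
  have invol: "\<sigma> (\<sigma> t) = t" for t
    using ne[of t] ne[of "t - 1"] ne[of "t + 1"] by (auto simp: \<sigma>_def point_def add.commute)
  have inj: "inj_on \<sigma> A" for A
    by (metis invol inj_onI)
  \<comment> \<open>Only beads congruent to \<open>i\<close> move down, and \<open>b\<close> is not congruent to \<open>i\<close>.\<close>
  have ge: "\<sigma> t \<ge> b" if "t \<in> B" for t
    using that b(2,4) by (cases "t = b") (auto simp: \<sigma>_def point_def)
  define B' where "B' = \<sigma> ` B"
  have "card B' = card B" "finite B'" "B' \<subseteq> {b..}"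
    using b ge by (auto simp: B'_def card_image[OF inj])
  then obtain q where q: "is_partition q" "\<And>i. part_count e s q i = bead_count e b s B' i"
    using exists_partition[of e B' b s] assms(1) b(5) by auto
  have step: "(\<sigma> t - k) div int e
      = (t - k) div int e + (point e i (t + 1) - point e i t) * point e i k" for t k
    using div_step[of e t k] div_step[of e "t - 1" k] ne[of t] assms(1)
    by (auto simp: \<sigma>_def point_def)
  have "(\<Sum>u\<in>B'. (u - k) div int e) = (\<Sum>t\<in>B. (\<sigma> t - k) div int e)" for k
    by (simp add: B'_def sum.reindex[OF inj])
  then have "bead_count e b s B' k = bead_count e b s B k + hub e [s] (bead_count e b s B) i * point e i k" for k
    using assms(1) b by (simp add: bead_count_def step sum.distrib hub_bead_count sum_distrib_right)
  then show ?thesis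
    unfolding b(6) using q by (intro exI[of _ q]) (simp add: fun_eq_iff)
qed

text \<open>
  The coordinate vectors of the elements of \<open>Q_set e s\<close>, extended periodically to all integers so
  that the indices \<open>i - 1\<close> and \<open>i + 1\<close> wrap around.
\<close>

definition contents :: "nat \<Rightarrow> int list \<Rightarrow> (int \<Rightarrow> int) set" where
  "contents e s = {\<lambda>i. int (residue_count e s L i) | L. is_multipartition (length s) L}"

lemma residue_count_components:
  assumes "length L = length s"
  shows "int (residue_count e s L i) = (\<Sum>j<length s. part_count e (s ! j) (L ! j) i)"
proof -
  let ?P = "\<lambda>j. {(a, b) \<in> young_diagram (L ! j). (int b - int a + s ! j) mod int e = i mod int e}"
  have "{n \<in> nodes L. residue e s n = i mod int e}
      = (\<Union>j<length s. (\<lambda>(a, b). (a, b, Suc j)) ` ?P j)" (is "?A = ?B")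
  proof (intro set_eqI iffI)
    fix n assume n: "n \<in> ?A"
    obtain a b j where abj: "n = (a, b, j)" by (cases n)
    with n obtain j' where "j = Suc j'" by (cases j) (auto simp: nodes_def)
    with n abj show "n \<in> ?B" using assms by (auto simp: nodes_def)
  qed (use assms in \<open>auto simp: nodes_def\<close>)
  moreover have "card ?B = (\<Sum>j<length s. card ((\<lambda>(a, b). (a, b, Suc j)) ` ?P j))"
    by (rule card_UN_disjoint) (auto intro!: finite_imageI finite_subset[OF _ finite_young_diagram])
  moreover have "card ((\<lambda>(a, b). (a, b, Suc j)) ` ?P j) = card (?P j)" for j
    by (rule card_image) (auto simp: inj_on_def)
  ultimately show ?thesis
    by (simp add: residue_count_def part_count_def)
qed

lemma contents_iff:
  "c \<in> contents e s \<longleftrightarrow>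
     (\<exists>P. (\<forall>j<length s. is_partition (P j)) \<and> c = (\<lambda>i. \<Sum>j<length s. part_count e (s ! j) (P j) i))"
proof
  assume "c \<in> contents e s"
  then obtain L where "is_multipartition (length s) L" "c = (\<lambda>i. int (residue_count e s L i))"
    by (auto simp: contents_def)
  then show "\<exists>P. (\<forall>j<length s. is_partition (P j)) \<and> c = (\<lambda>i. \<Sum>j<length s. part_count e (s ! j) (P j) i)"
    by (intro exI[of _ "nth L"]) (simp add: is_multipartition_def residue_count_components)
next
  assume "\<exists>P. (\<forall>j<length s. is_partition (P j)) \<and> c = (\<lambda>i. \<Sum>j<length s. part_count e (s ! j) (P j) i)"
  then obtain P where P: "\<forall>j<length s. is_partition (P j)"
    "c = (\<lambda>i. \<Sum>j<length s. part_count e (s ! j) (P j) i)" by blast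
  have "is_multipartition (length s) (map P [0..<length s])"
    using P(1) by (auto simp: is_multipartition_def)
  moreover have "c = (\<lambda>i. int (residue_count e s (map P [0..<length s]) i))"
    by (simp add: P(2) residue_count_components)
  ultimately show "c \<in> contents e s"
    unfolding contents_def by blast
qed

text \<open>
  The hub is additive over the components, so that statements about single partitions carry over
  to multipartitions one component at a time.
\<close>

lemma hub_components:
  "hub e s (\<lambda>i. \<Sum>j<length s. f j i) i = (\<Sum>j<length s. hub e [s ! j] (f j) i)"
  by (simp add: hub_def laplacian_def sum_subtractf sum_distrib_left)

lemma zero_in_contents: "(\<lambda>i. 0) \<in> contents e s"
  unfolding contents_iff by (intro exI[of _ "\<lambda>_. []"]) (simp add: is_partition_def)

lemma contents_nonneg: "c \<in> contents e s \<Longrightarrow> c i \<ge> 0"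
  by (auto simp: contents_def)

lemma contents_add_point:
  assumes "e \<ge> 2" "c \<in> contents e s" "hub e s c i > 0"
  shows "(\<lambda>k. c k + point e i k) \<in> contents e s"
proof -
  obtain P where P: "\<And>j. j < length s \<Longrightarrow> is_partition (P j)"
      "c = (\<lambda>i. \<Sum>j<length s. part_count e (s ! j) (P j) i)"
    using assms(2) unfolding contents_iff by blast
  have "(\<Sum>j<length s. hub e [s ! j] (part_count e (s ! j) (P j)) i) > 0"
    using assms(3) by (simp add: P(2) hub_components)
  then obtain j where j: "j < length s" "hub e [s ! j] (part_count e (s ! j) (P j)) i > 0"
    by (meson lessThan_iff not_less sum_nonpos)
  obtain q where q: "is_partition q"
      "part_count e (s ! j) q = (\<lambda>k. part_count e (s ! j) (P j) k + point e i k)"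
    using add_node[OF assms(1) P(1) j(2)] j(1) by blast
  have "(\<Sum>l<length s. part_count e (s ! l) ((P(j := q)) l) k) = c k + point e i k" for k
    using j(1) by (simp add: P(2) sum.remove[of "{..<length s}" j] q(2))
  then show ?thesis
    using P(1) q(1) unfolding contents_iff by (intro exI[of _ "P(j := q)"]) auto
qed

lemma contents_reflect:
  assumes "e \<ge> 2" "c \<in> contents e s"
  shows "(\<lambda>k. c k + hub e s c i * point e i k) \<in> contents e s"
proof -
  obtain P where P: "\<And>j. j < length s \<Longrightarrow> is_partition (P j)"
      "c = (\<lambda>i. \<Sum>j<length s. part_count e (s ! j) (P j) i)"
    using assms(2) unfolding contents_iff by blast
  have "\<forall>j\<in>{..<length s}. \<exists>q. is_partition q \<and> part_count e (s ! j) q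
      = (\<lambda>k. part_count e (s ! j) (P j) k
             + hub e [s ! j] (part_count e (s ! j) (P j)) i * point e i k)"
    using reflect_partition[OF assms(1) P(1)] by blast
  then obtain R where R: "\<And>j. j < length s \<Longrightarrow> is_partition (R j)"
      "\<And>j. j < length s \<Longrightarrow> part_count e (s ! j) (R j)
        = (\<lambda>k. part_count e (s ! j) (P j) k
               + hub e [s ! j] (part_count e (s ! j) (P j)) i * point e i k)"
    unfolding bchoice_iff by auto
  have "c k + hub e s c i * point e i k = (\<Sum>j<length s. part_count e (s ! j) (R j) k)" for k
    by (simp add: R(2) P(2) hub_components sum.distrib sum_distrib_right)
  then show ?thesis
    using R(1) unfolding contents_iff by (intro exI[of _ R]) auto
qed

section \<open>The Cartan form on periodic functions\<close>

definition periodic :: "nat \<Rightarrow> (int \<Rightarrow> int) \<Rightarrow> bool" where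
  "periodic e f \<longleftrightarrow> (\<forall>i. f (i + int e) = f i)"

lemma periodic_mod:
  assumes "periodic e f"
  shows "f (i mod int e) = f i"
proof -
  have nat_mult: "f (k + int n * int e) = f k" for n k
  proof (induction n arbitrary: k)
    case (Suc n)
    then show ?case
      using assms Suc.IH[of "k + int e"] by (simp add: periodic_def algebra_simps)
  qed simp
  show ?thesis
  proof (cases "i div int e \<ge> 0")
    case True
    then show ?thesis
      using nat_mult[of "i mod int e" "nat (i div int e)"] by simp
  next
    case False
    then show ?thesis
      using nat_mult[of i "nat (- (i div int e))"] by (simp add: minus_div_mult_eq_mod)
  qed
qed

lemma periodic_point: "periodic e (point e i)"
  by (simp add: periodic_def point_def)

lemma periodic_shift: "periodic e f \<Longrightarrow> periodic e (\<lambda>i. f (i + k))"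
  unfolding periodic_def by (metis add.commute add.left_commute)

lemma sum_periodic_window:
  assumes "periodic e f"
  shows "(\<Sum>i\<in>{a..<a + int e}. f i) = (\<Sum>i\<in>{0..<int e}. f i)"
proof (cases "e = 0")
  case False
  have step: "(\<Sum>i\<in>{a + 1..<a + 1 + int e}. f i) = (\<Sum>i\<in>{a..<a + int e}. f i)" for a
  proof -
    have "insert a {a + 1..<a + 1 + int e} = insert (a + int e) {a..<a + int e}"
      by auto
    then have "sum f (insert a {a + 1..<a + 1 + int e}) = sum f (insert (a + int e) {a..<a + int e})"
      by simp
    then show ?thesis
      using assms by (simp add: periodic_def)
  qed
  show ?thesis
  proof (induction a rule: int_induct[of _ 0])
    case (step2 i)
    then show ?case using step[of "i - 1"] by simp
  qed (simp_all add: step)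
qed simp

lemma sum_periodic_shift:
  assumes "periodic e f"
  shows "(\<Sum>i\<in>{0..<int e}. f (i + k)) = (\<Sum>i\<in>{0..<int e}. f i)"
proof -
  have "(\<Sum>i\<in>{0..<int e}. f (i + k)) = (\<Sum>i\<in>{k..<k + int e}. f i)"
    by (rule sum.reindex_bij_witness[of _ "\<lambda>i. i - k" "\<lambda>i. i + k"]) auto
  with sum_periodic_window[OF assms] show ?thesis by simp
qed

lemma sum_point_mult:
  assumes "e \<ge> 1" "periodic e f"
  shows "(\<Sum>k\<in>{0..<int e}. point e i k * f k) = f i"
proof -
  have "(\<Sum>k\<in>{0..<int e}. point e i k * f k) = (\<Sum>k\<in>{0..<int e}. if k = i mod int e then f k else 0)"
    by (rule sum.cong) (auto simp: point_def)
  also have "\<dots> = f (i mod int e)"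
    using assms(1) by (simp add: sum.delta)
  finally show ?thesis
    by (simp add: periodic_mod[OF assms(2)])
qed

lemma periodic_laplacian: "periodic e c \<Longrightarrow> periodic e (laplacian c)"
  unfolding periodic_def laplacian_def
  by (metis add_diff_eq diff_add_eq add.commute add.left_commute)

text \<open>
  For \<open>e = 2\<close> the neighbours \<open>i - 1\<close> and \<open>i + 1\<close> coincide modulo \<open>e\<close>, but they still differ
  from \<open>i\<close>; for \<open>e = 1\<close> the value would be 0.
\<close>

lemma laplacian_point: "e \<ge> 2 \<Longrightarrow> laplacian (point e i) i = 2"
proof -
  assume "e \<ge> 2"
  then have "\<not> int e dvd 1" by simp
  then have "(i - 1) mod int e \<noteq> i mod int e" "(i + 1) mod int e \<noteq> i mod int e"
    by (simp_all add: mod_eq_dvd_iff)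
  then show ?thesis by (simp add: laplacian_def point_def)
qed

lemma laplacian_symmetric:
  assumes "periodic e c" "periodic e d"
  shows "(\<Sum>i\<in>{0..<int e}. c i * laplacian d i) = (\<Sum>i\<in>{0..<int e}. d i * laplacian c i)"
proof -
  have "(\<Sum>i\<in>{0..<int e}. f i * g (i - 1)) = (\<Sum>i\<in>{0..<int e}. g i * f (i + 1))"
    if "periodic e f" "periodic e g" for f g
    using sum_periodic_shift[of e "\<lambda>i. f i * g (i - 1)" 1] that
      periodic_shift[OF that(2), of "-1"]
    by (simp add: periodic_def mult.commute)
  from this[OF assms] this[OF assms(2,1)] show ?thesis
    by (simp add: laplacian_def algebra_simps sum.distrib sum_subtractf sum_distrib_left)
qed

definition energy :: "nat \<Rightarrow> (int \<Rightarrow> int) \<Rightarrow> int" where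
  "energy e c = (\<Sum>i\<in>{0..<int e}. (c i - c (i + 1))\<^sup>2)"

text \<open>
  Summation by parts: \<open>energy\<close> is the quadratic form of the affine Cartan matrix, and
  \<open>laplacian\<close> is the matrix itself.
\<close>

lemma energy_laplacian:
  assumes "periodic e c"
  shows "energy e c = (\<Sum>i\<in>{0..<int e}. c i * laplacian c i)"
proof -
  have "(\<Sum>i\<in>{0..<int e}. c i * c (i - 1)) = (\<Sum>i\<in>{0..<int e}. c i * c (i + 1))"
    using sum_periodic_shift[of e "\<lambda>i. c i * c (i - 1)" 1] assms
      periodic_shift[OF assms, of "-1"]
    by (simp add: periodic_def mult.commute)
  moreover have "(\<Sum>i\<in>{0..<int e}. (c (i + 1))\<^sup>2) = (\<Sum>i\<in>{0..<int e}. (c i)\<^sup>2)"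
    using sum_periodic_shift[of e "\<lambda>i. (c i)\<^sup>2" 1] assms by (simp add: periodic_def)
  ultimately show ?thesis
    by (simp add: energy_def laplacian_def power2_diff sum.distrib sum_subtractf algebra_simps
        power2_eq_square sum_distrib_left)
qed

lemma even_energy:
  assumes "periodic e c"
  shows "even (energy e c)"
proof -
  have "(\<Sum>i\<in>{0..<int e}. (c (i + 1))\<^sup>2) = (\<Sum>i\<in>{0..<int e}. (c i)\<^sup>2)"
    using sum_periodic_shift[of e "\<lambda>i. (c i)\<^sup>2" 1] assms by (simp add: periodic_def)
  then have "energy e c = 2 * ((\<Sum>i\<in>{0..<int e}. (c i)\<^sup>2) - (\<Sum>i\<in>{0..<int e}. c i * c (i + 1)))"
    by (simp add: energy_def power2_diff sum.distrib sum_subtractf sum_distrib_left mult.assoc)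
  then show ?thesis by simp
qed

text \<open>
  The factor 2 keeps the value within the integers for arbitrary \<open>c\<close>; for periodic \<open>c\<close> it is even by
  \<open>even_energy\<close>.
\<close>

definition double_weight :: "nat \<Rightarrow> int list \<Rightarrow> (int \<Rightarrow> int) \<Rightarrow> int" where
  "double_weight e s c = 2 * (\<Sum>j<length s. c (s ! j)) - energy e c"

text \<open>
  Along the direction of a single residue the weight is a quadratic polynomial with leading term
  \<open>- x\<^sup>2\<close> and linear term \<open>h x\<close>, where \<open>h\<close> is the hub; it takes equal values at \<open>0\<close> and \<open>h\<close>.
\<close>

lemma double_weight_reflect:
  assumes "e \<ge> 2" "periodic e c"
  shows "double_weight e s (\<lambda>k. c k + hub e s c i * point e i k) = double_weight e s c"
proof -
  define h where "h = hub e s c i"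
  define c' where "c' = (\<lambda>k. c k + h * point e i k)"
  have c': "periodic e c'"
    using assms(2) periodic_point[of e i] by (simp add: c'_def periodic_def)
  have lap: "laplacian c' k = laplacian c k + h * laplacian (point e i) k" for k
    by (simp add: laplacian_def c'_def algebra_simps)
  have e1: "e \<ge> 1" using assms(1) by simp
  have "energy e c' = (\<Sum>k\<in>{0..<int e}. c k * laplacian c k)
      + h * (\<Sum>k\<in>{0..<int e}. c k * laplacian (point e i) k)
      + h * (\<Sum>k\<in>{0..<int e}. point e i k * laplacian c k)
      + h * h * (\<Sum>k\<in>{0..<int e}. point e i k * laplacian (point e i) k)"
    by (simp add: energy_laplacian[OF c'] lap) (simp add: c'_def algebra_simps sum.distrib sum_distrib_left)
  also have "\<dots> = energy e c + 2 * h * laplacian c i + 2 * h * h"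
    using sum_point_mult[OF e1 periodic_laplacian[OF assms(2)], of i]
      sum_point_mult[OF e1 periodic_laplacian[OF periodic_point], of i i]
      laplacian_symmetric[OF assms(2) periodic_point, of i] laplacian_point[OF assms(1), of i]
    by (simp add: energy_laplacian[OF assms(2)])
  finally have "energy e c' = energy e c + 2 * h * (laplacian c i + h)"
    by (simp add: algebra_simps)
  also have "laplacian c i + h = (\<Sum>j<length s. point e i (s ! j))"
    by (simp add: h_def hub_def point_sym[of e i])
  finally show ?thesis
    unfolding double_weight_def h_def[symmetric] c'_def[symmetric]
    by (simp add: c'_def sum.distrib sum_distrib_left algebra_simps)
qed

lemma contents_periodic: "c \<in> contents e s \<Longrightarrow> periodic e c"
  by (auto simp: contents_def periodic_def residue_count_def)

lemma sum_hub:
  assumes "e \<ge> 1" "periodic e c"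
  shows "(\<Sum>i\<in>{0..<int e}. hub e s c i) = int (length s)"
proof -
  have "(\<Sum>i\<in>{0..<int e}. laplacian c i) = 0"
    using sum_periodic_shift[OF assms(2), of 1] sum_periodic_shift[OF assms(2), of "-1"]
    by (simp add: laplacian_def sum_subtractf flip: sum_distrib_left)
  moreover have "(\<Sum>i\<in>{0..<int e}. \<Sum>j<length s. point e (s ! j) i) = int (length s)"
    using sum_point_mult[OF assms(1), of "\<lambda>_. 1"] by (subst sum.swap) (simp add: periodic_def)
  ultimately show ?thesis
    by (simp add: hub_def sum_subtractf)
qed

lemma energy_zero_imp_constant:
  assumes "periodic e c" "energy e c = 0" "e \<ge> 1"
  shows "c i = c 0"
proof -
  have "c k = c (k + 1)" if "k \<in> {0..<int e}" for k
    using assms(2) that by (simp add: energy_def sum_nonneg_eq_0_iff)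
  then have "int n < int e \<Longrightarrow> c (int n) = c 0" for n
  proof (induction n)
    case (Suc n)
    then show ?case using \<open>\<And>k. k \<in> {0..<int e} \<Longrightarrow> c k = c (k + 1)\<close>[of "int n"]
      by (simp add: add.commute)
  qed simp
  from this[of "nat (i mod int e)"] show ?thesis
    using assms(3) periodic_mod[OF assms(1), of i] by simp
qed

section \<open>Dominant vectors are residue counts\<close>

text \<open>
  Below \<open>d\<close>, nodes are added to \<open>c\<close> as long as some residue \<open>i\<close> with \<open>c i < d i\<close> has a positive hub.
  When this is no longer possible, the difference \<open>z\<close> of \<open>d\<close> and \<open>c\<close> satisfies \<open>laplacian z i \<le> 0\<close> wherever
  \<open>z i > 0\<close>, as \<open>d\<close> is dominant. So the energy of \<open>z\<close> is at most 0 and \<open>z\<close> is constant. A positive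
  constant would make all hubs of \<open>c\<close> nonpositive, although they add up to the number of
  components.
\<close>

lemma dominant_in_contents:
  assumes "e \<ge> 2" "s \<noteq> []" and d: "periodic e d" "\<And>i. hub e s d i \<ge> 0"
    and "c \<in> contents e s" "\<And>i. c i \<le> d i"
  shows "d \<in> contents e s"
  using assms(5,6)
proof (induction "nat (\<Sum>i\<in>{0..<int e}. d i - c i)" arbitrary: c rule: less_induct)
  case less
  note c = contents_periodic[OF less.prems(1)]
  define z where "z i = d i - c i" for i
  have z: "periodic e z" "\<And>i. z i \<ge> 0"
    using c d(1) less.prems(2) by (auto simp: z_def periodic_def)
  have e1: "e \<ge> 1" using assms(1) by simp
  show ?case
  proof (cases "\<exists>i. c i < d i \<and> hub e s c i > 0")
    case True
    then obtain i where i: "c i < d i" "hub e s c i > 0" by blast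
    define c' where "c' = (\<lambda>k. c k + point e i k)"
    have "c' \<in> contents e s"
      unfolding c'_def using contents_add_point[OF assms(1) less.prems(1) i(2)] .
    moreover have "c' k \<le> d k" for k
    proof (cases "k mod int e = i mod int e")
      case True
      then show ?thesis
        using i(1) periodic_mod[OF c, of k] periodic_mod[OF c, of i]
          periodic_mod[OF d(1), of k] periodic_mod[OF d(1), of i]
        by (simp add: c'_def point_def)
    qed (use less.prems(2) in \<open>simp add: c'_def point_def\<close>)
    moreover have "(\<Sum>k\<in>{0..<int e}. d k - c' k) = (\<Sum>k\<in>{0..<int e}. d k - c k) - 1"
      using sum_point_mult[OF e1, of "\<lambda>_. 1" i]
      by (simp add: c'_def sum_subtractf sum.distrib periodic_def)
    moreover have "(\<Sum>k\<in>{0..<int e}. d k - c' k) \<ge> 0"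
      using \<open>\<And>k. c' k \<le> d k\<close> by (simp add: sum_nonneg)
    ultimately show ?thesis
      using less.hyps[of c'] by simp
  next
    case False
    have "hub e s d i = hub e s c i - laplacian z i" for i
      by (simp add: hub_def laplacian_def z_def)
    then have lap: "laplacian z i = hub e s c i - hub e s d i" for i
      by simp
    have "z i * laplacian z i \<le> 0" for i
    proof (cases "z i = 0")
      case nonzero: False
      then have "c i < d i"
        using less.prems(2)[of i] by (simp add: z_def)
      then have "hub e s c i \<le> 0"
        using False by (meson not_less)
      then show ?thesis
        using lap[of i] d(2)[of i] z(2)[of i] by (simp add: mult_nonneg_nonpos)
    qed simp
    then have "energy e z \<le> 0"
      by (simp add: energy_laplacian[OF z(1)] sum_nonpos)
    then have "energy e z = 0"
      by (intro antisym) (simp_all add: energy_def sum_nonneg)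
    then have const: "z i = z 0" for i
      using energy_zero_imp_constant[OF z(1) _ e1] by blast
    have "z 0 = 0"
    proof (rule ccontr)
      assume "z 0 \<noteq> 0"
      then have "c i < d i" for i
        using const[of i] z(2)[of i] by (simp add: z_def)
      then have "hub e s c i \<le> 0" for i
        using False by (meson not_less)
      then have "(\<Sum>i\<in>{0..<int e}. hub e s c i) \<le> 0"
        by (simp add: sum_nonpos)
      with assms(2) show False
        by (simp add: sum_hub[OF e1 c])
    qed
    then have "d = c"
      using const by (auto simp: z_def fun_eq_iff)
    with less.prems(1) show ?thesis by simp
  qed
qed

section \<open>Reduced vectors up to reflection\<close>

definition reduced :: "nat \<Rightarrow> int list \<Rightarrow> (int \<Rightarrow> int) \<Rightarrow> bool" where
  "reduced e s c \<longleftrightarrow> c \<in> contents e s \<and> (\<lambda>i. c i - 1) \<notin> contents e s"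

lemma hub_reflected:
  assumes "e \<ge> 2"
  shows "hub e s (\<lambda>k. c k + h * point e i k) i = hub e s c i - 2 * h"
proof -
  have "laplacian (\<lambda>k. c k + h * point e i k) i = laplacian c i + h * laplacian (point e i) i"
    by (simp add: laplacian_def algebra_simps)
  then show ?thesis
    by (simp add: hub_def laplacian_point[OF assms])
qed

text \<open>
  Subtracting a constant does not change hubs, and a second reflection at the same residue undoes
  the first one. So a vector of residue counts below the reflected vector by \<open>\<delta>\<close> would reflect to one
  below the original vector by \<open>\<delta>\<close>.
\<close>

lemma reduced_reflect:
  assumes "e \<ge> 2" "reduced e s c"
  shows "reduced e s (\<lambda>k. c k + hub e s c i * point e i k)"
proof -
  define h where "h = hub e s c i"
  have "(\<lambda>k. (c k + h * point e i k) - 1) \<notin> contents e s"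
  proof
    assume *: "(\<lambda>k. (c k + h * point e i k) - 1) \<in> contents e s"
    have "hub e s (\<lambda>k. (c k + h * point e i k) - 1) i = hub e s (\<lambda>k. c k + h * point e i k) i"
      by (simp add: hub_def laplacian_def)
    also have "\<dots> = - h"
      by (simp add: hub_reflected[OF assms(1)] h_def)
    finally have "(\<lambda>k. c k - 1) \<in> contents e s"
      using contents_reflect[OF assms(1) *, of i] by simp
    with assms(2) show False by (simp add: reduced_def)
  qed
  then show ?thesis
    using contents_reflect[OF assms(1)] assms(2) by (simp add: reduced_def h_def)
qed

text \<open>
  Reflecting at a negative hub decreases the number of nodes, so the process ends in a dominant
  reduced vector; if all its entries were positive, \<open>dominant_in_contents\<close> would apply to its
  difference with \<open>\<delta>\<close>.
\<close>

lemma reduced_equivalent_with_zero: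
  assumes "e \<ge> 2" "s \<noteq> []" "reduced e s c"
  shows "\<exists>d k. periodic e d \<and> d k = 0 \<and> double_weight e s d = double_weight e s c"
  using assms(3)
proof (induction "nat (\<Sum>i\<in>{0..<int e}. c i)" arbitrary: c rule: less_induct)
  case less
  have cont: "c \<in> contents e s" using less.prems by (simp add: reduced_def)
  note c = contents_periodic[OF cont]
  have e1: "e \<ge> 1" using assms(1) by simp
  show ?case
  proof (cases "\<exists>i. hub e s c i < 0")
    case True
    then obtain i where i: "hub e s c i < 0" by blast
    define c' where "c' = (\<lambda>k. c k + hub e s c i * point e i k)"
    have red: "reduced e s c'"
      unfolding c'_def by (rule reduced_reflect[OF assms(1) less.prems])
    then have "c' k \<ge> 0" for k unfolding reduced_def using contents_nonneg by blast
    then have "(\<Sum>k\<in>{0..<int e}. c' k) \<ge> 0" by (simp add: sum_nonneg)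
    moreover have "(\<Sum>k\<in>{0..<int e}. c' k) = (\<Sum>k\<in>{0..<int e}. c k) + hub e s c i"
      using sum_point_mult[OF e1, of "\<lambda>_. 1" i]
      by (simp add: c'_def sum.distrib periodic_def flip: sum_distrib_left)
    ultimately show ?thesis
      using less.hyps[OF _ red] i double_weight_reflect[OF assms(1) c, of s i]
      by (simp add: c'_def)
  next
    case False
    have "\<exists>k. c k = 0"
    proof (rule ccontr)
      assume "\<nexists>k. c k = 0"
      then have pos: "c k - 1 \<ge> 0" for k
        using contents_nonneg[OF cont, of k] by (metis diff_ge_0_iff_ge int_one_le_iff_zero_less order_le_less)
      have "hub e s (\<lambda>k. c k - 1) = hub e s c"
        by (simp add: hub_def laplacian_def fun_eq_iff)
      then have "(\<lambda>k. c k - 1) \<in> contents e s"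
        using dominant_in_contents[OF assms(1,2) _ _ zero_in_contents, of "\<lambda>k. c k - 1"] False pos c
        by (simp add: periodic_def not_less)
      with less.prems show False by (simp add: reduced_def)
    qed
    with c show ?thesis by blast
  qed
qed

section \<open>Bounding the weight of a vector with a zero\<close>

text \<open>
  Cauchy-Schwarz for the increments of \<open>c\<close>, obtained from the nonnegativity of
  their variance so as to stay within the integers.
\<close>

lemma increment_squares_bound:
  fixes c :: "int \<Rightarrow> int"
  shows "(c (a + int m) - c a)\<^sup>2 \<le> int m * (\<Sum>i\<in>{a..<a + int m}. (c i - c (i + 1))\<^sup>2)"
proof (cases "m = 0")
  case False
  define x where "x = c (a + int m) - c a"
  define S where "S = (\<Sum>i\<in>{a..<a + int m}. (c i - c (i + 1))\<^sup>2)"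
  have tel: "(\<Sum>i\<in>{a..<a + int n}. c i - c (i + 1)) = c a - c (a + int n)" for n
  proof (induction n)
    case (Suc n)
    have "{a..<a + int (Suc n)} = insert (a + int n) {a..<a + int n}" by auto
    with Suc show ?case by (simp add: algebra_simps)
  qed simp
  have "0 \<le> (\<Sum>i\<in>{a..<a + int m}. (int m * (c i - c (i + 1)) + x)\<^sup>2)"
    by (simp add: sum_nonneg)
  also have "\<dots> = (\<Sum>i\<in>{a..<a + int m}.
      (int m)\<^sup>2 * (c i - c (i + 1))\<^sup>2 + 2 * int m * x * (c i - c (i + 1)) + x\<^sup>2)"
    by (simp add: power2_eq_square algebra_simps)
  also have "\<dots> = (int m)\<^sup>2 * S + 2 * int m * x * (\<Sum>i\<in>{a..<a + int m}. c i - c (i + 1)) + int m * x\<^sup>2"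
    by (simp add: sum.distrib S_def flip: sum_distrib_left)
  also have "\<dots> = int m * (int m * S - x\<^sup>2)"
    by (simp only: tel) (simp add: x_def power2_eq_square algebra_simps)
  finally show ?thesis
    using False by (simp add: zero_le_mult_iff x_def S_def)
qed simp

text \<open>
  With \<open>q = m (e - m)\<close> the two hypotheses on \<open>x\<^sup>2\<close> combine to \<open>e x\<^sup>2 \<le> q E\<close>. Completing the square
  in \<open>x\<close> bounds the left-hand side by \<open>r\<^sup>2 q\<close>, and \<open>4 q \<le> e\<^sup>2\<close>.
\<close>

lemma quadratic_bound:
  fixes x E r :: int
  assumes "0 < m" "m < e" "x\<^sup>2 \<le> int m * E1" "x\<^sup>2 \<le> int (e - m) * E2" "E = E1 + E2"
  shows "2 * r * int e * x - int e * E \<le> r\<^sup>2 * ((int e)\<^sup>2 div 4)"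
proof -
  define q where "q = int m * int (e - m)"
  have q: "q > 0" using assms(1,2) by (simp add: q_def)
  have e: "int e = int m + int (e - m)" using assms(2) by simp
  have "int e * x\<^sup>2 = int (e - m) * x\<^sup>2 + int m * x\<^sup>2"
    by (subst e) (simp add: algebra_simps)
  also have "\<dots> \<le> int (e - m) * (int m * E1) + int m * (int (e - m) * E2)"
    by (intro add_mono mult_left_mono assms) auto
  also have "\<dots> = q * E" by (simp add: assms(5) q_def algebra_simps)
  finally have "int e * (int e * x\<^sup>2) \<le> int e * (q * E)"
    by (intro mult_left_mono) auto
  moreover have "0 \<le> (r * q - int e * x)\<^sup>2" by simp
  ultimately have "q * (2 * r * int e * x - int e * E) \<le> q * (r\<^sup>2 * q)"
    by (simp add: power2_eq_square algebra_simps)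
  then have "2 * r * int e * x - int e * E \<le> r\<^sup>2 * q"
    using q by simp
  moreover have "4 * q \<le> (int e)\<^sup>2"
  proof -
    have "0 \<le> (int m - int (e - m))\<^sup>2" by simp
    then show ?thesis
      by (subst e) (simp add: q_def power2_eq_square algebra_simps)
  qed
  then have "r\<^sup>2 * q \<le> r\<^sup>2 * ((int e)\<^sup>2 div 4)"
    by (intro mult_left_mono) auto
  ultimately show ?thesis by linarith
qed

lemma energy_bound:
  assumes "e \<ge> 1" "periodic e c" "c k = 0"
  shows "2 * r * int e * c a - int e * energy e c \<le> r\<^sup>2 * ((int e)\<^sup>2 div 4)"
proof -
  define m where "m = nat ((a - k) mod int e)"
  have m: "int m = (a - k) mod int e" "m < e"
    using assms(1) by (auto simp: m_def nat_less_iff)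
  have ca: "c (k + int m) = c a"
    using periodic_mod[OF assms(2), of "k + int m"] periodic_mod[OF assms(2), of a]
    by (simp add: m(1) mod_simps)
  show ?thesis
  proof (cases "m = 0")
    case True
    then have "c a = 0" using ca assms(3) by simp
    moreover have "int e * energy e c \<ge> 0" by (simp add: energy_def sum_nonneg)
    moreover have "r\<^sup>2 * ((int e)\<^sup>2 div 4) \<ge> 0" by (simp add: pos_imp_zdiv_nonneg_iff)
    ultimately show ?thesis by simp
  next
    case False
    let ?S = "\<lambda>A. \<Sum>i\<in>A. (c i - c (i + 1))\<^sup>2"
    have "periodic e (\<lambda>i. (c i - c (i + 1))\<^sup>2)"
      using assms(2) periodic_shift[OF assms(2), of 1] by (simp add: periodic_def)
    then have "energy e c = ?S {k..<k + int e}"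
      by (simp add: energy_def sum_periodic_window)
    also have "{k..<k + int e} = {k..<k + int m} \<union> {k + int m..<k + int m + int (e - m)}"
      using m(2) by auto
    also have "?S \<dots> = ?S {k..<k + int m} + ?S {k + int m..<k + int m + int (e - m)}"
      by (rule sum.union_disjoint) auto
    finally have split: "energy e c = \<dots>" .
    have "c (k + int m + int (e - m)) = 0"
      using assms(2,3) m(2) by (simp add: periodic_def)
    then show ?thesis
      using increment_squares_bound[of c k m] increment_squares_bound[of c "k + int m" "e - m"]
        False m(2) assms(3) ca
      by (intro quadratic_bound[OF _ _ _ _ split]) auto
  qed
qed

text \<open>
  Up to the factor \<open>2e\<close>, the weight is the average over the charges of the quantities bounded in \<open>energy_bound\<close>, taken
  with \<open>r\<close> equal to the number of components.
\<close>

lemma double_weight_bound: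
  assumes "e \<ge> 1" "s \<noteq> []" "periodic e c" "c k = 0"
  shows "int e * double_weight e s c \<le> (int (length s))\<^sup>2 * ((int e)\<^sup>2 div 4)"
proof -
  define r where "r = int (length s)"
  have "r * (int e * double_weight e s c)
      = (\<Sum>j<length s. 2 * r * int e * c (s ! j) - int e * energy e c)"
    by (simp add: double_weight_def r_def sum_subtractf algebra_simps sum_distrib_left)
  also have "\<dots> \<le> (\<Sum>j<length s. r\<^sup>2 * ((int e)\<^sup>2 div 4))"
    by (intro sum_mono energy_bound[OF assms(1,3,4)])
  also have "\<dots> = r * (r\<^sup>2 * ((int e)\<^sup>2 div 4))"
    by (simp add: r_def)
  finally show ?thesis
    using assms(2) by (simp add: r_def)
qed

section \<open>Weights of reduced multicores\<close>

lemma weight_eq_double_weight: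
  "weight e s L = real_of_int (double_weight e s (\<lambda>i. int (residue_count e s L i))) / 2"
  by (simp add: weight_def double_weight_def energy_def sum.atLeast1_atMost_eq
      diff_divide_distrib)

lemma lookup_alpha:
  "Poly_Mapping.lookup (alpha e s L) i = (if i \<in> {0..<int e} then int (residue_count e s L i) else 0)"
  by (simp add: alpha_def lookup_sum if_distrib cong: if_cong)

lemma lookup_delta:
  "Poly_Mapping.lookup (delta e) i = (if i \<in> {0..<int e} then 1 else 0)"
  by (simp add: delta_def lookup_sum if_distrib cong: if_cong)

lemma reduced_multicore_imp_reduced:
  assumes "reduced_multicore e s L"
  shows "reduced e s (\<lambda>i. int (residue_count e s L i))"
proof -
  have "(\<lambda>i. int (residue_count e s L i) - 1) \<notin> contents e s"
  proof
    assume "(\<lambda>i. int (residue_count e s L i) - 1) \<in> contents e s"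
    then obtain K where K: "is_multipartition (length s) K"
        "\<And>i. int (residue_count e s L i) - 1 = int (residue_count e s K i)"
      by (auto simp: contents_def fun_eq_iff)
    have "alpha e s L - delta e = alpha e s K"
      by (rule poly_mapping_eqI) (simp add: lookup_minus lookup_alpha lookup_delta K(2))
    with K(1) assms show False
      by (auto simp: reduced_multicore_def Q_set_def)
  qed
  then show ?thesis
    using assms by (auto simp: reduced_def contents_def reduced_multicore_def)
qed

lemma reduced_multicore_if_count_zero:
  assumes "is_multipartition (length s) L" "i \<in> {0..<int e}" "residue_count e s L i = 0"
  shows "reduced_multicore e s L"
proof -
  have "alpha e s L - delta e \<noteq> alpha e s K" for K
  proof
    assume "alpha e s L - delta e = alpha e s K"
    then have "Poly_Mapping.lookup (alpha e s L - delta e) i = Poly_Mapping.lookup (alpha e s K) i"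
      by simp
    with assms(2,3) show False
      by (simp add: lookup_minus lookup_alpha lookup_delta)
  qed
  with assms(1) show ?thesis
    by (auto simp: reduced_multicore_def Q_set_def)
qed

lemma N'_eq: "N' r e = \<lfloor>(real r)\<^sup>2 * real_of_int ((int e)\<^sup>2 div 4) / (2 * real e)\<rfloor>"
proof -
  have "\<lfloor>(real e)\<^sup>2 / 4\<rfloor> = (int e)\<^sup>2 div 4"
    using floor_divide_of_int_eq[of "(int e)\<^sup>2" 4, where ?'a = real] by simp
  then show ?thesis by (simp add: N'_def)
qed

lemma weight_le_N':
  assumes "e \<ge> 2" "s \<noteq> []" "reduced_multicore e s L"
  shows "weight e s L \<le> real_of_int (N' (length s) e)"
proof -
  define c where "c = (\<lambda>i. int (residue_count e s L i))"
  have red: "reduced e s c"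
    unfolding c_def by (rule reduced_multicore_imp_reduced[OF assms(3)])
  then obtain d k where "periodic e d" "d k = 0" "double_weight e s d = double_weight e s c"
    using reduced_equivalent_with_zero[OF assms(1,2)] by blast
  then have bound: "int e * double_weight e s c \<le> (int (length s))\<^sup>2 * ((int e)\<^sup>2 div 4)"
    using double_weight_bound[of e s d k] assms(1,2) by simp
  have "periodic e c"
    using red contents_periodic by (auto simp: reduced_def)
  then have "even (double_weight e s c)"
    by (simp add: double_weight_def even_energy)
  then obtain w where w: "double_weight e s c = 2 * w" by blast
  have "real_of_int (int e * (2 * w)) \<le> real_of_int ((int (length s))\<^sup>2 * ((int e)\<^sup>2 div 4))"
    using bound w by (simp only: of_int_le_iff)
  then have "real_of_int w \<le> (real (length s))\<^sup>2 * real_of_int ((int e)\<^sup>2 div 4) / (2 * real e)"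
    using assms(1) by (simp add: field_simps)
  then have "w \<le> N' (length s) e"
    by (simp add: N'_eq le_floor_iff)
  then show ?thesis
    by (simp add: weight_eq_double_weight w flip: c_def)
qed

section \<open>Multipartitions built from squares\<close>

text \<open>
  The contents \<open>b - a\<close> in a square of side \<open>k\<close> lie strictly between \<open>- k\<close> and \<open>k\<close>, and the value
  \<open>d\<close> occurs \<open>k - |d|\<close> times. The two summands belong to the lifts \<open>i\<close> and \<open>i - e\<close> of the
  residue. The formula is needed at \<open>i = e\<close> too, because the energy refers to the count at \<open>i + 1\<close>.
\<close>

lemma square_part_count:
  assumes "e \<ge> 1" "2 * k \<le> e" "0 \<le> i" "i \<le> int e"
  shows "part_count e 0 (replicate k k) i = max 0 (int k - i) + max 0 (i - int (e - k))"
proof -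
  have base: "part_count e 0 (replicate k k) i = max 0 (int k - i) + max 0 (i - int (e - k))"
    if i: "0 \<le> i" "i < int e" for i
  proof -
    have res: "d mod int e = i \<longleftrightarrow> d = i \<or> d = i - int e" if "\<bar>d\<bar> < int e" for d
    proof
      assume *: "d mod int e = i"
      show "d = i \<or> d = i - int e"
      proof (cases "d \<ge> 0")
        case False
        then have "(d + int e) mod int e = d + int e"
          using that by (intro mod_pos_pos_trivial) auto
        with * show ?thesis by simp
      qed (use * that in \<open>simp add: mod_pos_pos_trivial\<close>)
    next
      assume "d = i \<or> d = i - int e"
      then have "d mod int e = i mod int e"
        by (elim disjE) (simp_all add: mod_eq_dvd_iff)
      then show "d mod int e = i" using i by simp
    qed
    let ?A = "(\<lambda>a. (a, a + nat i)) ` {1..k - nat i}"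
    let ?B = "(\<lambda>b. (b + nat (int e - i), b)) ` {1..k - nat (int e - i)}"
    have "{(a, b) \<in> young_diagram (replicate k k). (int b - int a + 0) mod int e = i mod int e} = ?A \<union> ?B"
    proof (intro set_eqI iffI)
      fix z assume z: "z \<in> {(a, b) \<in> young_diagram (replicate k k). (int b - int a + 0) mod int e = i mod int e}"
      obtain a b where ab: "z = (a, b)" by (cases z)
      with z have r: "1 \<le> a" "a \<le> k" "1 \<le> b" "b \<le> k" "(int b - int a) mod int e = i"
        using i by (auto simp: young_diagram_def)
      then have "int b - int a = i \<or> int b - int a = i - int e"
        using assms(2) by (subst res[symmetric]) auto
      then show "z \<in> ?A \<union> ?B"
      proof
        assume "int b - int a = i"
        then have "b = a + nat i" using i by simp
        then show ?thesis using r ab by auto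
      next
        assume "int b - int a = i - int e"
        then have "a = b + nat (int e - i)" using i by simp
        then show ?thesis using r ab by auto
      qed
    next
      fix z assume "z \<in> ?A \<union> ?B"
      then show "z \<in> {(a, b) \<in> young_diagram (replicate k k). (int b - int a + 0) mod int e = i mod int e}"
      proof
        assume "z \<in> ?A"
        then show ?thesis using i by (auto simp: young_diagram_def)
      next
        assume "z \<in> ?B"
        then obtain b where b: "z = (b + nat (int e - i), b)" "1 \<le> b" "b + nat (int e - i) \<le> k"
          by auto
        have "(int b - int (b + nat (int e - i))) mod int e = i"
          using i b(2,3) assms(2) by (subst res) auto
        then show ?thesis using i b by (auto simp: young_diagram_def)
      qed
    qed
    then have "part_count e 0 (replicate k k) i = int (card (?A \<union> ?B))"
      by (simp only: part_count_def)
    also have "card (?A \<union> ?B) = card ?A + card ?B"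
      using i by (intro card_Un_disjoint) auto
    also have "card ?A = k - nat i"
      by (subst card_image) (simp_all add: inj_on_def)
    also have "card ?B = k - nat (int e - i)"
      by (subst card_image) (simp_all add: inj_on_def)
    also have "int (k - nat i + (k - nat (int e - i))) = int (k - nat i) + int (k - nat (int e - i))"
      by (rule of_nat_add)
    also have "int (k - nat i) = max 0 (int k - i)"
      using i by (cases "i \<le> int k") (simp_all add: of_nat_diff nat_le_iff)
    also have "int (k - nat (int e - i)) = max 0 (i - int (e - k))"
      using i assms(2) by (cases "int e - i \<le> int k") (simp_all add: of_nat_diff nat_le_iff)
    finally show ?thesis .
  qed
  show ?thesis
  proof (cases "i = int e")
    case True
    then have "part_count e 0 (replicate k k) i = part_count e 0 (replicate k k) 0"
      by (simp add: part_count_def)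
    with base[of 0] True assms show ?thesis by simp
  qed (use base assms in simp)
qed

text \<open>
  The counts descend by one step on the \<open>k\<close> first residues, ascend by one step on the \<open>k\<close> last ones,
  and are constant in between.
\<close>

lemma square_energy:
  fixes m :: int
  assumes "2 * k \<le> e"
  defines "f \<equiv> \<lambda>i. max 0 (int k - i) + max 0 (i - int (e - k))"
  shows "(\<Sum>i\<in>{0..<int e}. (m * f i - m * f (i + 1))\<^sup>2) = 2 * int k * m\<^sup>2"
proof -
  have "(m * f i - m * f (i + 1))\<^sup>2 = m\<^sup>2 * (if i < int k then 1 else 0) + m\<^sup>2 * (if int (e - k) \<le> i then 1 else 0)"
    if "i \<in> {0..<int e}" for i
  proof -
    have "f i - f (i + 1) = (if i < int k then 1 else 0) - (if int (e - k) \<le> i then 1 else 0)"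
      using that assms(1) by (auto simp: f_def)
    moreover have "\<not> (i < int k \<and> int (e - k) \<le> i)" using assms(1) by auto
    ultimately show ?thesis
      by (auto simp flip: right_diff_distrib simp: power_mult_distrib)
  qed
  then have "(\<Sum>i\<in>{0..<int e}. (m * f i - m * f (i + 1))\<^sup>2)
      = m\<^sup>2 * int (card {i \<in> {0..<int e}. i < int k}) + m\<^sup>2 * int (card {i \<in> {0..<int e}. int (e - k) \<le> i})"
    by (simp add: sum.distrib flip: sum_distrib_left sum.inter_filter)
  also have "{i \<in> {0..<int e}. i < int k} = {0..<int k}" using assms(1) by auto
  also have "{i \<in> {0..<int e}. int (e - k) \<le> i} = {int (e - k)..<int e}" by auto
  finally show ?thesis
    using assms(1) by (simp add: algebra_simps)
qed

lemma exists_square_multicore: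
  assumes "e \<ge> 1" "2 * k \<le> e" "m \<le> r"
  shows "\<exists>s L. length s = r \<and> reduced_multicore e s L
    \<and> weight e s L = real_of_int (int k * (int m * (int r - int m)))"
proof -
  define s where "s = replicate r (0 :: int)"
  define L where "L = replicate m (replicate k k) @ replicate (r - m) []"
  let ?f = "\<lambda>i. max 0 (int k - i) + max 0 (i - int (e - k))"
  have len: "length s = r" "length L = r" using assms(3) by (auto simp: s_def L_def)
  have multi: "is_multipartition (length s) L"
  proof -
    have "is_partition (replicate k k)" for k
      by (auto simp: is_partition_def sorted_wrt_iff_nth_less)
    then show ?thesis
      using len by (auto simp: is_multipartition_def L_def is_partition_def)
  qed
  have count: "int (residue_count e s L i) = int m * ?f i" if "0 \<le> i" "i \<le> int e" for i
  proof -
    have "int (residue_count e s L i) = (\<Sum>j<r. if j < m then ?f i else 0)"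
      unfolding residue_count_components[OF len(2)[folded len(1)]] len(1)
      using square_part_count[OF assms(1,2) that]
      by (intro sum.cong) (auto simp: s_def L_def nth_append)
    also have "\<dots> = (\<Sum>j\<in>{j \<in> {..<r}. j < m}. ?f i)"
      by (rule sum.inter_filter[symmetric]) simp
    also have "{j \<in> {..<r}. j < m} = {..<m}" using assms(3) by auto
    finally show ?thesis by simp
  qed
  have red: "reduced_multicore e s L"
    using count[of "int k"] assms(1,2) multi
    by (intro reduced_multicore_if_count_zero[of _ _ "int k"]) auto
  have "energy e (\<lambda>i. int (residue_count e s L i)) = 2 * int k * (int m)\<^sup>2"
    unfolding energy_def using square_energy[OF assms(2), of "int m"] count
    by (subst sum.cong[OF refl, where h = "\<lambda>i. (int m * ?f i - int m * ?f (i + 1))\<^sup>2"]) auto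
  moreover have "(\<Sum>j<length s. int (residue_count e s L (s ! j))) = int r * (int m * int k)"
    using count[of 0] assms(2) by (simp add: s_def)
  ultimately have "double_weight e s (\<lambda>i. int (residue_count e s L i))
      = 2 * (int k * (int m * (int r - int m)))"
    by (simp add: double_weight_def power2_eq_square algebra_simps)
  then have "weight e s L = real_of_int (int k * (int m * (int r - int m)))"
    unfolding weight_eq_double_weight by simp
  with red len(1) show ?thesis by blast
qed

theorem corollary3p29:
  fixes e r :: nat
  assumes "e \<ge> 2" and "r \<ge> 2"
  shows "ereal (real_of_int (\<lfloor>real e / 2\<rfloor> * \<lfloor>(real r)\<^sup>2 / 4\<rfloor>)) \<le> N r e
    \<and> N r e \<le> ereal (real_of_int (N' r e))
    \<and> real_of_int (N' r e) \<le> real e * (real r)\<^sup>2 / 8"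
proof (intro conjI)
  have "\<lfloor>real e / 2\<rfloor> = int (e div 2)"
    using floor_divide_of_nat_eq[of e 2, where ?'a = real] by simp
  moreover have "\<lfloor>(real r)\<^sup>2 / 4\<rfloor> = int (r div 2) * (int r - int (r div 2))"
  proof -
    have "\<lfloor>(real r)\<^sup>2 / 4\<rfloor> = int (r\<^sup>2 div 4)"
      using floor_divide_of_nat_eq[of "r\<^sup>2" 4, where ?'a = real] by simp
    moreover have "r\<^sup>2 div 4 = (r div 2) * (r - r div 2)"
    proof (cases "even r")
      case True
      then obtain n where "r = 2 * n" by blast
      then show ?thesis by (simp add: power2_eq_square)
    next
      case False
      then obtain n where n: "r = 2 * n + 1" using oddE by blast
      then have "r\<^sup>2 = 1 + 4 * (n * (n + 1))" by (simp add: power2_eq_square algebra_simps)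
      then have "r\<^sup>2 div 4 = n * (n + 1)" by simp
      then show ?thesis using n by simp
    qed
    ultimately show ?thesis by (simp add: of_nat_diff)
  qed
  ultimately obtain s L where "length s = r" "reduced_multicore e s L"
      "weight e s L = real_of_int (\<lfloor>real e / 2\<rfloor> * \<lfloor>(real r)\<^sup>2 / 4\<rfloor>)"
    using exists_square_multicore[of e "e div 2" "r div 2" r] assms by auto
  then show "ereal (real_of_int (\<lfloor>real e / 2\<rfloor> * \<lfloor>(real r)\<^sup>2 / 4\<rfloor>)) \<le> N r e"
    unfolding N_def by (intro Sup_upper) (metis (mono_tags, lifting) mem_Collect_eq)
next
  show "N r e \<le> ereal (real_of_int (N' r e))"
    unfolding N_def
  proof (rule Sup_least)
    fix x assume "x \<in> {ereal (weight e s L) |s L. length s = r \<and> reduced_multicore e s L}"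
    then obtain s L where x: "x = ereal (weight e s L)" "length s = r" "reduced_multicore e s L"
      by blast
    then have "s \<noteq> []" using assms(2) by auto
    then show "x \<le> ereal (real_of_int (N' r e))"
      using weight_le_N'[OF assms(1) _ x(3)] x(1,2) by simp
  qed
next
  have "real_of_int (N' r e) \<le> (real r)\<^sup>2 / (2 * real e) * real_of_int \<lfloor>(real e)\<^sup>2 / 4\<rfloor>"
    unfolding N'_def by (rule of_int_floor_le)
  also have "\<dots> \<le> (real r)\<^sup>2 / (2 * real e) * ((real e)\<^sup>2 / 4)"
    by (intro mult_left_mono of_int_floor_le) simp
  also have "\<dots> = real e * (real r)\<^sup>2 / 8"
    using assms(1) by (simp add: power2_eq_square)
  finally show "real_of_int (N' r e) \<le> real e * (real r)\<^sup>2 / 8" .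
qed

end
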